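(* Let the training data points $x^{(k)}$ be sampled from a (potentially unknown) distribution $\mu$, with corresponding time derivatives $\dot x^{(k)}=F(x^{(k)})$. Neglecting sparsity constraints, minimizing the SINDy loss function leads to the system $\Phi_X\Phi_X^\top\Xi^\top=\Phi_X\dot X^\top$, which decouples into the $n$ problems $\Phi_X\Phi_X^\top\Xi_\ell^\top=\Phi_X\dot X_\ell^\top$, $\ell=1,\dots,n$. Dividing both sides by the number of data points $m$ and letting $m\to\infty$ yields $$\left[\tfrac1m\Phi_X\Phi_X^\top\right]_{ij}\longrightarrow\langle\phi_i,\phi_j\rangle_\mu,\qquad\left[\tfrac1m\Phi_X\dot X_\ell^\top\right]_i\longrightarrow\langle\phi_i,F_\ell\rangle_\mu .$$ That is, in the infinite data limit one solves the system of equations $$\big[\langle\phi_i,\phi_j\rangle_\mu\big]_{i,j=1}^N\,\Xi_\ell^\top=\big[\langle\phi_i,F_\ell\rangle_\mu\big]_{i=1}^N,\qquad \ell=1,\dots,n,$$ in the least-squares sense. Hence SINDy is a data-driven best approximation of $F$ using the basis functions $\{\phi_i\}_{i=1}^N$.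
   Context: Consider an autonomous ordinary differential equation $\dot x=F(x)$ with $F=(F_1,\dots,F_n)^\top:\mathbb R^n\to\mathbb R^n$, and basis functions $\phi=(\phi_1,\dots,\phi_N)^\top:\mathbb R^n\to\mathbb R^N$. Write $\langle f,g\rangle_\mu=\int f(x)\,g(x)\,\mathrm d\mu(x)$. Given training data $(x^{(k)},\dot x^{(k)})$, $k=1,\dots,m$, let $\Phi_X=[\phi(x^{(1)})\ \cdots\ \phi(x^{(m)})]\in\mathbb R^{N\times m}$ and $\dot X=[\dot x^{(1)}\ \cdots\ \dot x^{(m)}]\in\mathbb R^{n\times m}$. SINDy (without sparsity constraints) fits a model $\dot x=\Xi\,\phi(x)$ by minimizing the loss $L(\Xi)=\lVert\dot X-\Xi\,\Phi_X\rVert_F^2$ (Frobenius norm) over $\Xi\in\mathbb R^{n\times N}$; $\Xi_\ell$ and $\dot X_\ell$ denote the $\ell$th rows of $\Xi$ and $\dot X$. The best approximation of an element $f$ of a real Hilbert space using $\phi_1,\dots,\phi_N$ is the element $g=\sum_i\alpha_i\phi_i$ minimizing $\lVert f-g\rVert^2$; the coefficients solve $\sum_j\langle\phi_i,\phi_j\rangle\alpha_j=\langle\phi_i,f\rangle$, $i=1,\dots,N$. *)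

theory Defs
  imports "HOL-Probability.Probability"
begin

text \<open>
  The data matrices have a varying number m of columns. A matrix with rows indexed by
  \<^typ>\<open>'r\<close> is therefore given by a sequence of columns \<open>nat \<Rightarrow> real^'r\<close>, of which the
  first m, at positions \<open>0, \<dots>, m - 1\<close>, are used.
\<close>

text \<open>The product of A and the transpose of B, where A and B have m columns each.\<close>

definition mult_transpose ::
  "nat \<Rightarrow> (nat \<Rightarrow> real^'r::finite) \<Rightarrow> (nat \<Rightarrow> real^'s::finite) \<Rightarrow> real^'s^'r" where
  "mult_transpose m A B = (\<chi> i j. \<Sum>k<m. A k $ i * B k $ j)"

text \<open>The product of A, having m columns, and the transpose of the row vector r of length m.\<close>

definition mult_row_transpose ::
  "nat \<Rightarrow> (nat \<Rightarrow> real^'r::finite) \<Rightarrow> (nat \<Rightarrow> real) \<Rightarrow> real^'r" where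
  "mult_row_transpose m A r = (\<chi> i. \<Sum>k<m. A k $ i * r k)"

definition data_row :: "(nat \<Rightarrow> real^'r::finite) \<Rightarrow> 'r \<Rightarrow> nat \<Rightarrow> real" where
  "data_row A i = (\<lambda>k. A k $ i)"

definition frobenius_norm :: "nat \<Rightarrow> (nat \<Rightarrow> real^'r::finite) \<Rightarrow> real" where
  "frobenius_norm m A = sqrt (\<Sum>i\<in>UNIV. \<Sum>k<m. (A k $ i)\<^sup>2)"

text \<open>The k-th column of the product of \<open>\<Xi>\<close> and \<open>\<Phi>\<close> is \<open>\<Xi> *v \<Phi> k\<close>.\<close>

definition sindy_loss ::
  "nat \<Rightarrow> (nat \<Rightarrow> real^'N::finite) \<Rightarrow> (nat \<Rightarrow> real^'n::finite) \<Rightarrow> real^'N^'n \<Rightarrow> real" where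
  "sindy_loss m \<Phi> Xdot \<Xi> = (frobenius_norm m (\<lambda>k. Xdot k - \<Xi> *v \<Phi> k))\<^sup>2"

definition sindy_minimizer ::
  "nat \<Rightarrow> (nat \<Rightarrow> real^'N::finite) \<Rightarrow> (nat \<Rightarrow> real^'n::finite) \<Rightarrow> real^'N^'n \<Rightarrow> bool" where
  "sindy_minimizer m \<Phi> Xdot = is_arg_min (sindy_loss m \<Phi> Xdot) (\<lambda>_. True)"

definition least_squares_solution :: "real^'c::finite^'r::finite \<Rightarrow> real^'r \<Rightarrow> real^'c \<Rightarrow> bool" where
  "least_squares_solution A b = is_arg_min (\<lambda>v. (norm (A *v v - b))\<^sup>2) (\<lambda>_. True)"

text \<open>
  Elements of the Hilbert space of square integrable functions are represented by functions;
  the squared norm of f is \<open>l2_inner \<mu> f f\<close>. The Bochner integral is 0 for functions that are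
  not integrable, so these notions are meaningful only for measurable square integrable functions.
\<close>

definition l2_inner :: "'a measure \<Rightarrow> ('a \<Rightarrow> real) \<Rightarrow> ('a \<Rightarrow> real) \<Rightarrow> real" where
  "l2_inner \<mu> f g = (\<integral>x. f x * g x \<partial>\<mu>)"

definition l2_dist_sq :: "'a measure \<Rightarrow> ('a \<Rightarrow> real) \<Rightarrow> ('a \<Rightarrow> real) \<Rightarrow> real" where
  "l2_dist_sq \<mu> f g = l2_inner \<mu> (\<lambda>x. f x - g x) (\<lambda>x. f x - g x)"

definition square_integrable :: "'a measure \<Rightarrow> ('a \<Rightarrow> real) \<Rightarrow> bool" where
  "square_integrable \<mu> f \<longleftrightarrow> f \<in> borel_measurable \<mu> \<and> integrable \<mu> (\<lambda>x. (f x)\<^sup>2)"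

definition lin_comb :: "('a \<Rightarrow> real^'N::finite) \<Rightarrow> real^'N \<Rightarrow> 'a \<Rightarrow> real" where
  "lin_comb \<phi> \<alpha> = (\<lambda>x. \<Sum>i\<in>UNIV. \<alpha> $ i * \<phi> x $ i)"

definition best_approximation ::
  "'a measure \<Rightarrow> ('a \<Rightarrow> real^'N::finite) \<Rightarrow> ('a \<Rightarrow> real) \<Rightarrow> ('a \<Rightarrow> real) \<Rightarrow> bool" where
  "best_approximation \<mu> \<phi> f = is_arg_min (l2_dist_sq \<mu> f) (\<lambda>g. g \<in> range (lin_comb \<phi>))"

definition gram_matrix :: "'a measure \<Rightarrow> ('a \<Rightarrow> real^'N::finite) \<Rightarrow> real^'N^'N" where
  "gram_matrix \<mu> \<phi> = (\<chi> i j. l2_inner \<mu> (\<lambda>x. \<phi> x $ i) (\<lambda>x. \<phi> x $ j))"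

definition moment_vector ::
  "'a measure \<Rightarrow> ('a \<Rightarrow> real^'N::finite) \<Rightarrow> ('a \<Rightarrow> real) \<Rightarrow> real^'N" where
  "moment_vector \<mu> \<phi> f = (\<chi> i. l2_inner \<mu> (\<lambda>x. \<phi> x $ i) f)"

end

theory Submission
  imports Defs
begin

text \<open>
  For finite data the loss is a sum over the rows of \<open>\<Xi>\<close> of positive semidefinite quadratic
  functions, whose minimizers are the solutions of the normal equations; the same argument in
  \<open>L\<^sup>2(\<mu>)\<close> identifies best approximations. The limits of the matrix entries are the strong law
  of large numbers. If the limiting Gram matrix G is singular, the minimizers need not be bounded,
  but a vector u in the kernel of G satisfies \<open>u \<bullet> \<phi> = 0\<close> almost everywhere, so almost
  surely u is in the kernel of every empirical Gram matrix too. The components of the minimizers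
  orthogonal to the kernel of G then solve the same equations, and they are bounded.
\<close>

section \<open>The strong law of large numbers\<close>

text \<open>
  Garsia's argument for the maximal ergodic theorem, on the sequence space: with m n the maximal
  partial sum and B the event that the partial sums are unbounded above, B is shift invariant and
  \<open>m (n + 1) (s, \<omega>) - m n \<omega> = max (- m n \<omega>) (f s)\<close>. The integral of the left-hand side over B is
  nonnegative, because the shift preserves the measure and m is increasing in n; the right-hand
  side tends to f s on B. Since s and \<open>\<omega>\<close> are independent, the integral of f times the probability
  of B is nonnegative.
\<close>

primrec max_partial_sum :: "('a \<Rightarrow> real) \<Rightarrow> nat \<Rightarrow> (nat \<Rightarrow> 'a) \<Rightarrow> real" where
  "max_partial_sum f 0 \<omega> = 0"
| "max_partial_sum f (Suc n) \<omega> = max 0 (f (\<omega> 0) + max_partial_sum f n (\<lambda>i. \<omega> (Suc i)))"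

lemma max_partial_sum_nonneg: "0 \<le> max_partial_sum f n \<omega>"
  by (cases n) auto

lemma max_partial_sum_mono: "max_partial_sum f n \<omega> \<le> max_partial_sum f (Suc n) \<omega>"
proof (induction n arbitrary: \<omega>)
  case (Suc n)
  show ?case using Suc[of "\<lambda>i. \<omega> (Suc i)"] by auto
qed simp

lemma partial_sum_le_max_partial_sum: "(\<Sum>k<n. f (\<omega> k)) \<le> max_partial_sum f n \<omega>"
proof (induction n arbitrary: \<omega>)
  case (Suc n)
  show ?case
    using Suc[of "\<lambda>i. \<omega> (Suc i)"] by (simp only: sum.lessThan_Suc_shift) auto
qed simp

lemma max_partial_sum_le_sum_abs: "max_partial_sum f n \<omega> \<le> (\<Sum>k<n. \<bar>f (\<omega> k)\<bar>)"
proof (induction n arbitrary: \<omega>)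
  case (Suc n)
  have "0 \<le> (\<Sum>k<n. \<bar>f (\<omega> (Suc k))\<bar>)" by (simp add: sum_nonneg)
  then show ?case
    using Suc[of "\<lambda>i. \<omega> (Suc i)"] by (simp only: sum.lessThan_Suc_shift) auto
qed simp

text \<open>Thresholds are natural numbers so that the event is a countable intersection of
  countable unions, hence measurable.\<close>

definition unbounded_sums :: "('a \<Rightarrow> real) \<Rightarrow> (nat \<Rightarrow> 'a) \<Rightarrow> bool" where
  "unbounded_sums f \<omega> \<longleftrightarrow> (\<forall>c::nat. \<exists>n. real c < max_partial_sum f n \<omega>)"

text \<open>The maximal sums increase with n, so once one exceeds a threshold all later ones do; the
  Archimedean property supplies real thresholds.\<close>

lemma unbounded_sumsD:
  assumes "unbounded_sums f \<omega>"
  shows "\<forall>\<^sub>F n in sequentially. c < max_partial_sum f n \<omega>"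
proof -
  obtain c' where "c \<le> real c'" using real_arch_simple by blast
  then obtain n where "c < max_partial_sum f n \<omega>"
    using assms unfolding unbounded_sums_def by (meson le_less_trans)
  moreover have "max_partial_sum f n \<omega> \<le> max_partial_sum f k \<omega>" if "n \<le> k" for k
    using lift_Suc_mono_le[of "\<lambda>n. max_partial_sum f n \<omega>"] max_partial_sum_mono that by metis
  ultimately show ?thesis
    unfolding eventually_sequentially by (meson less_le_trans)
qed

text \<open>A new first term changes the maximal sums by \<open>f s\<close> only, up to truncation
  at 0, which cannot affect unboundedness. This is the shift invariance of the event B.\<close>

lemma unbounded_sums_case_nat: "unbounded_sums f (case_nat s \<omega>) \<longleftrightarrow> unbounded_sums f \<omega>"
proof -
  have shift: "max_partial_sum f (Suc n) (case_nat s \<omega>) = max 0 (f s + max_partial_sum f n \<omega>)" for n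
    by simp
  show ?thesis
  proof
    assume L: "unbounded_sums f (case_nat s \<omega>)"
    show "unbounded_sums f \<omega>"
      unfolding unbounded_sums_def
    proof
      fix c :: nat
      \<comment> \<open>The 0 in the threshold forces the maximum on the right to be attained by
        \<open>f s + max_partial_sum f n \<omega>\<close>; then \<open>f s\<close> cancels.\<close>
      have "\<forall>\<^sub>F n in sequentially. max 0 (f s + real c) < max_partial_sum f (Suc n) (case_nat s \<omega>)"
        using unbounded_sumsD[OF L] by (subst eventually_sequentially_Suc)
      then obtain n where "max 0 (f s + real c) < max_partial_sum f (Suc n) (case_nat s \<omega>)"
        unfolding eventually_sequentially by blast
      then show "\<exists>n. real c < max_partial_sum f n \<omega>"
        unfolding shift by (intro exI[of _ n]) auto
    qed
  next
    assume R: "unbounded_sums f \<omega>"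
    show "unbounded_sums f (case_nat s \<omega>)"
      unfolding unbounded_sums_def
    proof
      fix c :: nat
      obtain n where "real c - f s < max_partial_sum f n \<omega>"
        using unbounded_sumsD[OF R] unfolding eventually_sequentially by blast
      then show "\<exists>n. real c < max_partial_sum f n (case_nat s \<omega>)"
        by (intro exI[of _ "Suc n"]) (auto simp only: shift)
    qed
  qed
qed

section \<open>Integration on the sequence space and the law of large numbers there\<close>

context sequence_space
begin

lemma borel_measurable_max_partial_sum [measurable]:
  assumes [measurable]: "f \<in> borel_measurable M"
  shows "max_partial_sum f n \<in> borel_measurable S"
proof (induction n)
  case (Suc n)
  note [measurable] = Suc
  have [measurable]: "(\<lambda>\<omega> i. \<omega> (Suc i)) \<in> measurable S S"
    by (rule measurable_PiM_single') (auto simp: space_PiM)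
  show ?case by (simp cong: measurable_cong)
qed simp

lemma pred_unbounded_sums [measurable]:
  assumes [measurable]: "f \<in> borel_measurable M"
  shows "Measurable.pred S (unbounded_sums f)"
  unfolding unbounded_sums_def by measurable

lemma integrable_component:
  fixes f :: "'a \<Rightarrow> real"
  assumes "integrable M f"
  shows "integrable S (\<lambda>\<omega>. f (\<omega> k))"
  using assms integrable_distr_eq[of "\<lambda>\<omega>. \<omega> k" S M f] PiM_component[of k] by simp

lemma integrable_max_partial_sum:
  assumes "integrable M f"
  shows "integrable S (max_partial_sum f n)"
proof (rule Bochner_Integration.integrable_bound)
  show "integrable S (\<lambda>\<omega>. \<Sum>k<n. \<bar>f (\<omega> k)\<bar>)"
    using assms by (intro Bochner_Integration.integrable_sum integrable_abs integrable_component)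
  show "AE \<omega> in S. norm (max_partial_sum f n \<omega>) \<le> norm (\<Sum>k<n. \<bar>f (\<omega> k)\<bar>)"
    by (intro AE_I2) (simp add: max_partial_sum_le_sum_abs max_partial_sum_nonneg sum_nonneg)
qed (use assms in measurable)

lemma distr_pair_snd: "distr (M \<Otimes>\<^sub>M S) S snd = S"
proof (rule measure_eqI)
  fix A assume "A \<in> sets (distr (M \<Otimes>\<^sub>M S) S snd)"
  then have A: "A \<in> sets S" by simp
  then have "snd -` A \<inter> space (M \<Otimes>\<^sub>M S) = space M \<times> A"
    using sets.sets_into_space[OF A] by (auto simp: space_pair_measure)
  then show "emeasure (distr (M \<Otimes>\<^sub>M S) S snd) A = emeasure S A"
    using A by (simp add: emeasure_distr P.emeasure_pair_measure_Times M.emeasure_space_1)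
qed simp


lemma AE_not_unbounded_sums:
  assumes f: "integrable M f" and neg: "integral\<^sup>L M f < 0"
  shows "AE \<omega> in S. \<not> unbounded_sums f \<omega>"
proof -
  interpret Q: pair_prob_space M S ..
  have fm [measurable]: "f \<in> borel_measurable M" using f by simp
  let ?m = "max_partial_sum f" and ?B = "Collect (unbounded_sums f)"
  let ?T = "\<lambda>(s, \<omega>). case_nat s \<omega>"
  have B [measurable]: "{\<omega> \<in> space S. unbounded_sums f \<omega>} \<in> sets S" by measurable
  have T [measurable]: "?T \<in> measurable (M \<Otimes>\<^sub>M S) S" by measurable
  have ind [measurable]: "(\<lambda>\<omega>. indicator ?B \<omega> :: real) \<in> borel_measurable S"
    unfolding indicator_def by simp
  have meas_m [measurable]: "(\<lambda>\<omega>. indicator ?B \<omega> * ?m n \<omega>) \<in> borel_measurable S" for n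
    by measurable
  have int_m: "integrable S (\<lambda>\<omega>. indicator ?B \<omega> * ?m n \<omega>)" for n
    by (rule Bochner_Integration.integrable_bound[OF integrable_max_partial_sum[OF f, of n] meas_m])
      (simp add: indicator_def)
  let ?h = "\<lambda>n (s, \<omega>). indicator ?B \<omega> * max (- ?m n \<omega>) (f s)"
  have ge: "0 \<le> (\<integral>p. ?h n p \<partial>(M \<Otimes>\<^sub>M S))" for n
  proof -
    \<comment> \<open>Under the product measure \<open>?T p\<close> has law \<open>S\<close> by
      \<open>PiM_iter\<close>, and \<open>snd p\<close> has law \<open>S\<close> by
      \<open>distr_pair_snd\<close>. Both integrals over \<open>S\<close> thus move to one space,
      where the integrands can be subtracted pointwise.\<close>
    have S1: "integrable (M \<Otimes>\<^sub>M S) (\<lambda>p. indicator ?B (?T p) * ?m (Suc n) (?T p))"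
      using integrable_distr_eq[OF T meas_m, of "Suc n"] int_m[of "Suc n"] unfolding PiM_iter by blast
    have S1': "(\<integral>p. indicator ?B (?T p) * ?m (Suc n) (?T p) \<partial>(M \<Otimes>\<^sub>M S)) = (\<integral>\<omega>. indicator ?B \<omega> * ?m (Suc n) \<omega> \<partial>S)"
      using integral_distr[OF T meas_m, of "Suc n"] unfolding PiM_iter by (rule sym)
    have S2: "integrable (M \<Otimes>\<^sub>M S) (\<lambda>p. indicator ?B (snd p) * ?m n (snd p))"
      using integrable_distr_eq[OF measurable_snd meas_m, of M n] int_m[of n] unfolding distr_pair_snd by blast
    have S2': "(\<integral>p. indicator ?B (snd p) * ?m n (snd p) \<partial>(M \<Otimes>\<^sub>M S)) = (\<integral>\<omega>. indicator ?B \<omega> * ?m n \<omega> \<partial>S)"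
      using integral_distr[OF measurable_snd meas_m, of M n] unfolding distr_pair_snd by (rule sym)
    have "0 \<le> (\<integral>\<omega>. indicator ?B \<omega> * ?m (Suc n) \<omega> - indicator ?B \<omega> * ?m n \<omega> \<partial>S)"
      using max_partial_sum_mono[of f n]
      by (intro Bochner_Integration.integral_nonneg) (auto simp: indicator_def simp del: max_partial_sum.simps)
    also have "\<dots> = (\<integral>p. indicator ?B (?T p) * ?m (Suc n) (?T p) - indicator ?B (snd p) * ?m n (snd p) \<partial>(M \<Otimes>\<^sub>M S))"
      unfolding Bochner_Integration.integral_diff[OF int_m int_m]
        Bochner_Integration.integral_diff[OF S1 S2] S1' S2' ..
    also have "\<dots> = (\<integral>p. ?h n p \<partial>(M \<Otimes>\<^sub>M S))"
      by (intro Bochner_Integration.integral_cong)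
        (auto simp: indicator_def unbounded_sums_case_nat max_def)
    finally show ?thesis .
  qed
  let ?g = "\<lambda>(s, \<omega>). indicator ?B \<omega> * f s"
  have "integrable (M \<Otimes>\<^sub>M S) (\<lambda>p. f (fst p))"
    using integrable_distr_eq[OF measurable_fst fm, of S] f unfolding P.distr_pair_fst by blast
  then have int_fst: "integrable (M \<Otimes>\<^sub>M S) (\<lambda>p. \<bar>f (fst p)\<bar>)"
    by (rule integrable_abs)
  have lim: "(\<lambda>n. \<integral>p. ?h n p \<partial>(M \<Otimes>\<^sub>M S)) \<longlonglongrightarrow> (\<integral>p. ?g p \<partial>(M \<Otimes>\<^sub>M S))"
    and int_g: "integrable (M \<Otimes>\<^sub>M S) ?g"
  proof -
    \<comment> \<open>On \<open>?B\<close> the values \<open>?m n \<omega>\<close> eventually exceed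
      \<open>- f s\<close>, and from then on the maximum is \<open>f s\<close>; outside
      \<open>?B\<close> both sides are 0.\<close>
    have conv: "AE p in M \<Otimes>\<^sub>M S. (\<lambda>n. ?h n p) \<longlonglongrightarrow> ?g p"
    proof (intro AE_I2)
      fix p :: "'a \<times> (nat \<Rightarrow> 'a)"
      obtain s \<omega> where p: "p = (s, \<omega>)" by fastforce
      have "\<forall>\<^sub>F n in sequentially. ?h n p = ?g p"
      proof (cases "unbounded_sums f \<omega>")
        case True
        then show ?thesis
          using unbounded_sumsD[OF True, of "- f s"] by (auto elim!: eventually_mono simp: p)
      qed (simp add: p)
      then show "(\<lambda>n. ?h n p) \<longlonglongrightarrow> ?g p" by (rule tendsto_eventually)
    qed
    \<comment> \<open>Since \<open>- ?m n \<omega>\<close> is nonpositive, cutting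
      \<open>f s\<close> off from below at this level can only move it towards 0. The bound is
      therefore independent of n.\<close>
    have bd: "AE p in M \<Otimes>\<^sub>M S. norm (?h n p) \<le> \<bar>f (fst p)\<bar>" for n
    proof (intro AE_I2)
      fix p :: "'a \<times> (nat \<Rightarrow> 'a)"
      show "norm (?h n p) \<le> \<bar>f (fst p)\<bar>"
        using max_partial_sum_nonneg[of f n "snd p"] by (cases p) (auto simp: indicator_def)
    qed
    note * = _ _ int_fst conv bd
    show "(\<lambda>n. \<integral>p. ?h n p \<partial>(M \<Otimes>\<^sub>M S)) \<longlonglongrightarrow> (\<integral>p. ?g p \<partial>(M \<Otimes>\<^sub>M S))"
      by (rule integral_dominated_convergence[OF *]) simp_all
    show "integrable (M \<Otimes>\<^sub>M S) ?g"
      by (rule integrable_dominated_convergence[OF *]) simp_all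
  qed
  have "0 \<le> (\<integral>p. ?g p \<partial>(M \<Otimes>\<^sub>M S))"
    by (rule LIMSEQ_le_const[OF lim]) (use ge in blast)
  also have "\<dots> = (\<integral>s. (\<integral>\<omega>. indicator ?B \<omega> * f s \<partial>S) \<partial>M)"
    using Q.integral_fst'[OF int_g] by simp
  also have "\<dots> = (\<integral>\<omega>. indicator ?B \<omega> \<partial>S) * (\<integral>s. f s \<partial>M)"
    by simp
  \<comment> \<open>Measurability is known for the part of \<open>?B\<close> inside
    \<open>space S\<close>, so the indicator is restricted before its integral is read as a
    probability.\<close>
  also have "(\<integral>\<omega>. indicator ?B \<omega> \<partial>S) = (\<integral>\<omega>. indicator {\<omega> \<in> space S. unbounded_sums f \<omega>} \<omega> \<partial>S)"
    by (intro Bochner_Integration.integral_cong) (auto simp: indicator_def)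
  also have "\<dots> = measure S {\<omega> \<in> space S. unbounded_sums f \<omega>}"
    using sets.Int_space_eq2[OF B] by simp
  finally have "measure S {\<omega> \<in> space S. unbounded_sums f \<omega>} \<le> 0"
    using neg by (simp add: zero_le_mult_iff)
  then have "measure S {\<omega> \<in> space S. unbounded_sums f \<omega>} = 0"
    by (simp add: measure_le_0_iff)
  then have "emeasure S {\<omega> \<in> space S. unbounded_sums f \<omega>} = 0"
    by (simp add: P.emeasure_eq_measure)
  then show ?thesis
    by (subst AE_iff_measurable[OF B]) auto
qed

text \<open>Subtracting the mean plus e / 2 makes the integral negative, so almost surely the
  partial sums of the centered function stay below some c. The remaining e / 2 absorbs c / m for
  large m.\<close>

lemma AE_average_less:
  assumes f: "integrable M f" and e: "0 < e"
  shows "AE \<omega> in S. \<forall>\<^sub>F m in sequentially. (\<Sum>k<m. f (\<omega> k)) / real m < integral\<^sup>L M f + e"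
proof -
  define g where "g s = f s - (integral\<^sup>L M f + e / 2)" for s
  have "integrable M g" "integral\<^sup>L M g < 0"
    using f e M.prob_space unfolding g_def by simp_all
  then have "AE \<omega> in S. \<not> unbounded_sums g \<omega>" by (rule AE_not_unbounded_sums)
  then show ?thesis
  proof eventually_elim
    case (elim \<omega>)
    then obtain c :: nat where c: "max_partial_sum g n \<omega> \<le> real c" for n
      unfolding unbounded_sums_def by (auto simp: not_less)
    \<comment> \<open>Beyond \<open>m0\<close> the bound c is less than m * e / 2; starting at
      \<open>Suc m0\<close> also makes m positive for the division.\<close>
    obtain m0 :: nat where m0: "real c / (e / 2) < real m0" using reals_Archimedean2 by blast
    show ?case
      unfolding eventually_sequentially
    proof (intro exI allI impI)
      fix m assume m: "Suc m0 \<le> m"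
      have "real c < e / 2 * real m0"
        using m0 e by (simp add: field_simps)
      also have "\<dots> \<le> e / 2 * real m"
        using m e by (intro mult_left_mono) auto
      finally have "real c < e / 2 * real m" .
      moreover have "(\<Sum>k<m. f (\<omega> k)) - real m * (integral\<^sup>L M f + e / 2) \<le> real c"
        using order_trans[OF partial_sum_le_max_partial_sum c[of m]] by (simp add: g_def sum_subtractf)
      ultimately have "(\<Sum>k<m. f (\<omega> k)) < real m * (integral\<^sup>L M f + e)"
        by (simp add: algebra_simps)
      then show "(\<Sum>k<m. f (\<omega> k)) / real m < integral\<^sup>L M f + e"
        using m by (simp add: divide_less_eq mult.commute)
    qed
  qed
qed

text \<open>The one-sided bound is applied to f and to - f. The tolerances 1 / (j + 1) are
  countable, so a single null set serves all of them.\<close>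

theorem AE_average_tendsto:
  assumes f: "integrable M f"
  shows "AE \<omega> in S. (\<lambda>m. (\<Sum>k<m. f (\<omega> k)) / real m) \<longlonglongrightarrow> integral\<^sup>L M f"
proof -
  have up: "AE \<omega> in S. \<forall>j. \<forall>\<^sub>F m in sequentially.
      (\<Sum>k<m. f (\<omega> k)) / real m < integral\<^sup>L M f + 1 / real (Suc j)"
    by (intro AE_all_countable[THEN iffD2] allI AE_average_less f) simp
  have "integrable M (\<lambda>s. - f s)" using f by simp
  then have "AE \<omega> in S. \<forall>j. \<forall>\<^sub>F m in sequentially.
      (\<Sum>k<m. - f (\<omega> k)) / real m < (\<integral>s. - f s \<partial>M) + 1 / real (Suc j)"
    by (intro AE_all_countable[THEN iffD2] allI AE_average_less) simp_all
  with up show ?thesis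
  proof eventually_elim
    case (elim \<omega>)
    show ?case
    proof (rule tendstoI)
      fix e :: real assume "0 < e"
      then obtain j where j: "1 / real (Suc j) < e"
        using nat_approx_posE by blast
      show "\<forall>\<^sub>F m in sequentially. dist ((\<Sum>k<m. f (\<omega> k)) / real m) (integral\<^sup>L M f) < e"
        using elim(1)[rule_format, of j] elim(2)[rule_format, of j]
      proof eventually_elim
        case (elim m)
        then show ?case using j by (simp add: dist_real_def sum_negf abs_less_iff)
      qed
    qed
  qed
qed

end

text \<open>Independence and the common law make the joint law of the sequence the product measure,
  so the result carries over from the sequence space.\<close>

theorem (in prob_space) strong_law_of_large_numbers:
  fixes X :: "nat \<Rightarrow> 'a \<Rightarrow> 'b" and f :: "'b \<Rightarrow> real"
  assumes indep: "indep_vars (\<lambda>_. N) X UNIV"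
    and distr: "\<And>k. distr M N (X k) = D"
    and f: "integrable D f"
  shows "AE \<omega> in M. (\<lambda>m. (\<Sum>k<m. f (X k \<omega>)) / real m) \<longlonglongrightarrow> integral\<^sup>L D f"
proof -
  have X [measurable]: "X k \<in> measurable M N" for k
    using indep by (simp add: indep_vars_def)
  have law: "distr M (\<Pi>\<^sub>M i\<in>UNIV. N) (\<lambda>\<omega> i. X i \<omega>) = (\<Pi>\<^sub>M i\<in>UNIV. D)"
    using indep indep_vars_iff_distr_eq_PiM[of UNIV X "\<lambda>_. N"] X by (simp add: distr restrict_UNIV)
  interpret D: prob_space D
    using prob_space_distr[OF X] distr by metis
  interpret sequence_space D ..
  have "AE \<omega> in distr M (\<Pi>\<^sub>M i\<in>UNIV. N) (\<lambda>\<omega> i. X i \<omega>).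
      (\<lambda>m. (\<Sum>k<m. f (\<omega> k)) / real m) \<longlonglongrightarrow> integral\<^sup>L D f"
    unfolding law by (rule AE_average_tendsto[OF f])
  then show ?thesis
    by (rule AE_distrD[rotated]) (rule measurable_PiM_single', auto dest: measurable_space[OF X])
qed

section \<open>Quadratic functions and singular linear systems\<close>

text \<open>Cauchy-Schwarz in every row; \<open>norm A\<close> is the Frobenius norm, the Euclidean
  norm of the row norms.\<close>

lemma norm_matrix_vector_mult_le:
  fixes A :: "real^'n^'m"
  shows "norm (A *v x) \<le> norm A * norm x"
proof -
  have "norm (A *v x) \<le> L2_set (\<lambda>i. norm (A $ i) * norm x) UNIV"
    unfolding norm_vec_def[of "A *v x"]
    by (intro L2_set_mono) (simp_all add: matrix_vector_mul_component Cauchy_Schwarz_ineq2)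
  also have "\<dots> = norm A * norm x"
    by (simp add: norm_vec_def[of A] L2_set_left_distrib)
  finally show ?thesis .
qed

text \<open>The second-order expansion around v is exact, so a nonzero gradient would allow a
  descent step, and a zero gradient leaves only a nonnegative term. It serves both the SINDy loss
  and the L2 distance.\<close>

lemma quadratic_minimizer_iff:
  fixes G :: "real^'N^'N"
  assumes sym: "\<And>u v. u \<bullet> (G *v v) = v \<bullet> (G *v u)"
    and psd: "\<And>v. 0 \<le> v \<bullet> (G *v v)"
  shows "(\<forall>w. c - 2 * (v \<bullet> b) + v \<bullet> (G *v v) \<le> c - 2 * (w \<bullet> b) + w \<bullet> (G *v w)) \<longleftrightarrow> G *v v = b"
    (is "(\<forall>w. ?q v \<le> ?q w) \<longleftrightarrow> _")
proof -
  have expand: "?q (v + d) = ?q v + 2 * (d \<bullet> (G *v v - b)) + d \<bullet> (G *v d)" for d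
    using sym[of v d] by (simp add: algebra_simps)
  show ?thesis
  proof
    assume min: "\<forall>w. ?q v \<le> ?q w"
    define r where "r = G *v v - b"
    define D K where "D = r \<bullet> r" and "K = r \<bullet> (G *v r)"
    \<comment> \<open>A step - t r changes the value by t (t K - 2 D). This t gives t K \<le> D,
      hence a change of at most - t D; the summand 1 covers K = 0.\<close>
    define t where "t = D / (K + 1)"
    have K: "0 \<le> K" and D: "0 \<le> D" using psd by (auto simp: K_def D_def)
    have "0 \<le> 2 * ((- t *\<^sub>R r) \<bullet> (G *v v - b)) + (- t *\<^sub>R r) \<bullet> (G *v (- t *\<^sub>R r))"
      using min expand[of "- t *\<^sub>R r"] by (smt (verit))
    also have "\<dots> = t * (t * K - 2 * D)"
      unfolding K_def D_def r_def[symmetric]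
      by (simp add: algebra_simps linear_neg[OF matrix_vector_mul_linear])
    also have "t * K \<le> D"
      using K D by (simp add: t_def divide_le_eq algebra_simps)
    then have "t * (t * K - 2 * D) \<le> t * (- D)"
      using K D by (intro mult_left_mono) (auto simp: t_def)
    finally have "D = 0"
      using K D by (auto simp: t_def zero_le_mult_iff zero_le_divide_iff divide_le_0_iff mult_le_0_iff)
    then show "G *v v = b" by (simp add: D_def r_def)
  next
    assume "G *v v = b"
    then show "\<forall>w. ?q v \<le> ?q w"
      using expand psd by (metis (no_types) add.commute add_0 diff_add_cancel diff_self inner_zero_right
          le_add_same_cancel1 mult_zero_right)
  qed
qed

text \<open>Fredholm alternative: the part z of b orthogonal to the range lies in the kernel by
  symmetry, so it is orthogonal to b and therefore 0.\<close>

lemma symmetric_matrix_solvable: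
  fixes G :: "real^'N^'N"
  assumes sym: "\<And>u v. u \<bullet> (G *v v) = v \<bullet> (G *v u)"
    and ker: "\<And>v. G *v v = 0 \<Longrightarrow> v \<bullet> b = 0"
  obtains v where "G *v v = b"
proof -
  obtain y z where y: "y \<in> span (range ((*v) G))"
    and z: "\<And>w. w \<in> span (range ((*v) G)) \<Longrightarrow> orthogonal z w" and b: "b = y + z"
    using orthogonal_subspace_decomp_exists by blast
  have sp: "span (range ((*v) G)) = range ((*v) G)"
    by (simp add: span_eq_iff linear_subspace_image)
  have "v \<bullet> (G *v z) = 0" for v
    using z[of "G *v v"] sym[of v z] sp by (auto simp: orthogonal_def)
  then have "G *v z = 0" using inner_eq_zero_iff by blast
  then have "z \<bullet> b = 0" by (rule ker)
  then have "z \<bullet> z = 0"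
    using z[OF y] by (simp add: b inner_add_right orthogonal_def)
  then have "b = y" by (simp add: b)
  then show ?thesis using y sp that by auto
qed

text \<open>By \<open>ker\<close> the perturbed matrices act only on the orthogonal complement of
  the kernel of G, where G is bounded below. The second limit uses the seminorm of G because
  \<open>v m\<close> may diverge along the kernel.\<close>

lemma perturbed_singular_system:
  fixes G :: "real^'N^'N"
  assumes sym: "\<And>u v. u \<bullet> (G *v v) = v \<bullet> (G *v u)"
    and A: "A \<longlonglongrightarrow> G" and b: "b \<longlonglongrightarrow> b0"
    and eq: "\<And>m. A m *v v m = b m"
    and ker: "\<And>m u. G *v u = 0 \<Longrightarrow> A m *v u = 0"
  shows "(\<lambda>m. G *v v m) \<longlonglongrightarrow> b0"
    and "G *v a = b0 \<Longrightarrow> (\<lambda>m. (v m - a) \<bullet> (G *v (v m - a))) \<longlonglongrightarrow> 0"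
proof -
  define K where "K = {u. G *v u = 0}"
  define W where "W = {y. \<forall>x\<in>K. orthogonal x y}"
  have K: "subspace K" unfolding K_def by (rule linear_subspace_kernel) simp
  have W: "subspace W" unfolding W_def by (rule subspace_orthogonal_to_vectors)
  \<comment> \<open>\<open>w m\<close> will be the component of \<open>v m\<close> orthogonal to the
    kernel; neither G nor \<open>A m\<close> sees the difference.\<close>
  have exw: "\<exists>w. w \<in> W \<and> G *v (v m - w) = 0" for m
  proof -
    obtain y z where y: "y \<in> span K" and z: "\<And>w. w \<in> span K \<Longrightarrow> orthogonal z w"
      and vm: "v m = y + z"
      by (rule orthogonal_subspace_decomp_exists[of K "v m"]) (rule that)
    have "span K = K" using K by (simp only: span_eq_iff)
    then have "y \<in> K" using y by (simp only:)
    then have "G *v (v m - z) = 0" using vm by (simp add: K_def)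
    moreover have "z \<in> W"
      using z span_base[of _ K] by (simp add: W_def orthogonal_commute)
    ultimately show ?thesis by blast
  qed
  obtain w where wW: "w m \<in> W" and wv: "G *v (v m - w m) = 0" for m
    using exw by metis
  have Gw: "G *v v m = G *v w m" for m
    using wv[of m] by (simp add: matrix_vector_mult_diff_distrib)
  have Aw: "A m *v w m = b m" for m
    using ker[OF wv, of m m] eq[of m] by (simp add: matrix_vector_mult_diff_distrib)
  \<comment> \<open>G is injective on \<open>W\<close>, which in finite dimension yields a lower
    bound e for it there.\<close>
  have "\<forall>y\<in>W. G *v y = 0 \<longrightarrow> y = 0" by (auto simp: orthogonal_def K_def W_def)
  then obtain e where e: "0 < e" "\<And>y. y \<in> W \<Longrightarrow> e * norm y \<le> norm (G *v y)"
    using injective_imp_isometric[OF closed_subspace[OF W] W matrix_vector_mul_bounded_linear[of G]]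
    by auto
  have A0: "(\<lambda>m. norm (G - A m)) \<longlonglongrightarrow> 0"
    using tendsto_norm[OF tendsto_diff[OF tendsto_const[of G] A]] by simp
  obtain C where C: "norm (b m) \<le> C" for m
    using convergent_imp_Bseq[OF convergentI[OF b]] unfolding Bseq_def by auto
  have diff: "norm (G *v w m - b m) \<le> norm (G - A m) * norm (w m)" for m
    using norm_matrix_vector_mult_le[of "G - A m" "w m"]
    by (simp add: matrix_vector_mult_diff_rdistrib Aw)
  \<comment> \<open>Once \<open>A m\<close> is within e / 2 of G, half of the lower bound e
    survives, which leads to the constant 2 * C / e.\<close>
  have bounded: "\<forall>\<^sub>F m in sequentially. norm (w m) \<le> 2 * C / e"
    using order_tendstoD(2)[OF A0 half_gt_zero[OF e(1)]]
  proof eventually_elim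
    case (elim m)
    have "e * norm (w m) \<le> norm (G *v w m - b m) + norm (b m)"
      using e(2)[OF wW[of m]] norm_triangle_ineq[of "G *v w m - b m" "b m"] by simp
    also have "\<dots> \<le> e / 2 * norm (w m) + C"
      using diff[of m] C[of m] elim mult_right_mono[of "norm (G - A m)" "e / 2" "norm (w m)"] by simp
    finally show ?case using e(1) by (simp add: field_simps)
  qed
  have "(\<lambda>m. G *v w m - b m) \<longlonglongrightarrow> 0"
  proof (rule Lim_null_comparison)
    show "\<forall>\<^sub>F m in sequentially. norm (G *v w m - b m) \<le> norm (G - A m) * (2 * C / e)"
      using bounded
    proof eventually_elim
      case (elim m)
      then show ?case
        using diff[of m] mult_left_mono[OF elim, of "norm (G - A m)"] by simp
    qed
    show "(\<lambda>m. norm (G - A m) * (2 * C / e)) \<longlonglongrightarrow> 0"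
      using tendsto_mult_left_zero[OF A0] .
  qed
  from tendsto_add[OF this b] show lim: "(\<lambda>m. G *v v m) \<longlonglongrightarrow> b0"
    by (simp add: Gw)
  assume a: "G *v a = b0"
  \<comment> \<open>Symmetry removes the kernel component, possibly unbounded in m, from the left
    factor; the right factor tends to 0 by the first limit.\<close>
  have eq': "(v m - a) \<bullet> (G *v (v m - a)) = (w m - a) \<bullet> (G *v v m - b0)" for m
  proof -
    have "(v m - w m) \<bullet> (G *v (v m - a)) = 0"
      using sym[of "v m - w m" "v m - a"] by (simp add: wv)
    then show ?thesis
      by (simp add: a[symmetric] matrix_vector_mult_diff_distrib inner_diff_left)
  qed
  show "(\<lambda>m. (v m - a) \<bullet> (G *v (v m - a))) \<longlonglongrightarrow> 0"
    unfolding eq'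
  proof (rule Lim_null_comparison)
    show "\<forall>\<^sub>F m in sequentially. norm ((w m - a) \<bullet> (G *v v m - b0)) \<le> (2 * C / e + norm a) * norm (G *v v m - b0)"
      using bounded
    proof eventually_elim
      case (elim m)
      have "norm (w m - a) \<le> 2 * C / e + norm a"
        using norm_triangle_ineq4[of "w m" a] elim by simp
      then show ?case
        using Cauchy_Schwarz_ineq2[of "w m - a" "G *v v m - b0"] mult_right_mono[of "norm (w m - a)" "2 * C / e + norm a" "norm (G *v v m - b0)"]
        by simp
    qed
    show "(\<lambda>m. (2 * C / e + norm a) * norm (G *v v m - b0)) \<longlonglongrightarrow> 0"
      using lim by (intro tendsto_mult_right_zero tendsto_norm_zero) (simp add: LIM_zero_iff)
  qed
qed

section \<open>Normal equations of SINDy and of the best approximation\<close>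

lemma mult_transpose_mult_vec:
  "mult_transpose m A B *v v = (\<Sum>k<m. (B k \<bullet> v) *\<^sub>R A k)"
  by (simp add: vec_eq_iff mult_transpose_def matrix_vector_mult_def inner_vec_def
      sum_distrib_left sum_distrib_right sum.swap[of _ UNIV] ac_simps)

lemma mult_row_transpose_eq: "mult_row_transpose m A r = (\<Sum>k<m. r k *\<^sub>R A k)"
  by (simp add: vec_eq_iff mult_row_transpose_def mult.commute)

text \<open>This form makes symmetry and positive semidefiniteness of the empirical Gram matrix
  evident.\<close>

lemma inner_mult_transpose_self:
  "u \<bullet> (mult_transpose m A A *v v) = (\<Sum>k<m. (A k \<bullet> u) * (A k \<bullet> v))"
  by (simp add: mult_transpose_mult_vec inner_sum_right inner_commute ac_simps)

lemma normal_equations_rows_iff: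
  fixes A :: "nat \<Rightarrow> real^'N" and X :: "nat \<Rightarrow> real^'n" and \<Xi> :: "real^'N^'n"
  shows "mult_transpose m A A ** transpose \<Xi> = mult_transpose m A X \<longleftrightarrow>
    (\<forall>l. mult_transpose m A A *v row l \<Xi> = mult_row_transpose m A (data_row X l))"
  unfolding vec_eq_iff
  by (auto simp: matrix_matrix_mult_def matrix_vector_mult_def transpose_def row_def
      mult_row_transpose_def data_row_def mult_transpose_def[of m A X])

text \<open>The squared Frobenius norm is a sum over rows; expanding the squares puts each summand
  into the form of \<open>quadratic_minimizer_iff\<close>.\<close>

lemma sindy_loss_eq:
  "sindy_loss m A X \<Xi> = (\<Sum>l\<in>UNIV. (\<Sum>k<m. (data_row X l k)\<^sup>2)
     - 2 * (row l \<Xi> \<bullet> mult_row_transpose m A (data_row X l))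
     + row l \<Xi> \<bullet> (mult_transpose m A A *v row l \<Xi>))"
proof -
  have "sindy_loss m A X \<Xi> = (\<Sum>l\<in>UNIV. \<Sum>k<m. (data_row X l k - A k \<bullet> row l \<Xi>)\<^sup>2)"
    by (simp add: sindy_loss_def frobenius_norm_def sum_nonneg matrix_vector_mul_component
        data_row_def row_def inner_commute)
  also have "\<dots> = (\<Sum>l\<in>UNIV. (\<Sum>k<m. (data_row X l k)\<^sup>2)
     - 2 * (row l \<Xi> \<bullet> mult_row_transpose m A (data_row X l))
     + row l \<Xi> \<bullet> (mult_transpose m A A *v row l \<Xi>))"
    unfolding inner_mult_transpose_self mult_row_transpose_eq
  proof (intro sum.cong refl)
    fix l
    have sq: "(a - b)\<^sup>2 = a\<^sup>2 - 2 * (a * b) + b * b" for a b :: real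
      by (simp add: power2_eq_square algebra_simps)
    show "(\<Sum>k<m. (data_row X l k - A k \<bullet> row l \<Xi>)\<^sup>2) = (\<Sum>k<m. (data_row X l k)\<^sup>2)
      - 2 * (row l \<Xi> \<bullet> (\<Sum>k<m. data_row X l k *\<^sub>R A k))
      + (\<Sum>k<m. (A k \<bullet> row l \<Xi>) * (A k \<bullet> row l \<Xi>))"
      unfolding sq by (simp add: sum.distrib sum_subtractf sum_distrib_left inner_sum_right inner_commute)
  qed
  finally show ?thesis .
qed

text \<open>Rows vary independently: a competitor that differs from \<Xi> in row l alone isolates
  the summand \<open>q l\<close>.\<close>

lemma minimizer_sum_rows_iff:
  fixes q :: "'n::finite \<Rightarrow> real^'N \<Rightarrow> real" and \<Xi> :: "real^'N^'n"
  shows "(\<forall>Y::real^'N^'n. (\<Sum>l\<in>UNIV. q l (row l \<Xi>)) \<le> (\<Sum>l\<in>UNIV. q l (row l Y))) \<longleftrightarrow>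
    (\<forall>l v. q l (row l \<Xi>) \<le> q l v)"
proof safe
  fix l v
  assume min: "\<forall>Y::real^'N^'n. (\<Sum>l\<in>UNIV. q l (row l \<Xi>)) \<le> (\<Sum>l\<in>UNIV. q l (row l Y))"
  define Y :: "real^'N^'n" where "Y = (\<chi> i. if i = l then v else row i \<Xi>)"
  have Y: "row i Y = (if i = l then v else row i \<Xi>)" for i
    by (simp add: row_def Y_def vec_eq_iff)
  have "(\<Sum>l\<in>UNIV. q l (row l \<Xi>)) \<le> (\<Sum>l\<in>UNIV. q l (row l Y))" using min by blast
  then show "q l (row l \<Xi>) \<le> q l v"
    by (simp add: sum.remove[of UNIV l] Y)
qed (auto intro: sum_mono)

lemma sindy_minimizer_iff:
  "sindy_minimizer m A X \<Xi> \<longleftrightarrow>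
    (\<forall>l. mult_transpose m A A *v row l \<Xi> = mult_row_transpose m A (data_row X l))"
proof -
  have sym: "u \<bullet> (mult_transpose m A A *v v) = v \<bullet> (mult_transpose m A A *v u)" for u v
    by (simp add: inner_mult_transpose_self mult.commute)
  have psd: "0 \<le> v \<bullet> (mult_transpose m A A *v v)" for v
    by (simp add: inner_mult_transpose_self sum_nonneg)
  show ?thesis
    unfolding sindy_minimizer_def is_arg_min_linorder sindy_loss_eq
    using minimizer_sum_rows_iff[of "\<lambda>l v. (\<Sum>k<m. (data_row X l k)\<^sup>2)
     - 2 * (v \<bullet> mult_row_transpose m A (data_row X l)) + v \<bullet> (mult_transpose m A A *v v)" \<Xi>]
      quadratic_minimizer_iff[OF sym psd] by simp
qed

text \<open>Solvability makes the minimal residual 0, so only exact solutions attain it.\<close>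

lemma least_squares_solution_iff:
  fixes A :: "real^'c^'r"
  assumes "A *v v0 = b"
  shows "least_squares_solution A b v \<longleftrightarrow> A *v v = b"
  unfolding least_squares_solution_def is_arg_min_linorder
proof (intro iffI)
  assume "True \<and> (\<forall>w. True \<longrightarrow> (norm (A *v v - b))\<^sup>2 \<le> (norm (A *v w - b))\<^sup>2)"
  then have "(norm (A *v v - b))\<^sup>2 \<le> (norm (A *v v0 - b))\<^sup>2" by blast
  then show "A *v v = b" by (simp add: assms)
qed simp

section \<open>Infinite data: square integrable functions and best approximation\<close>

lemma lin_comb_eq_inner: "lin_comb \<phi> v x = v \<bullet> \<phi> x"
  by (simp add: lin_comb_def inner_vec_def)

lemma integrable_mult_square_integrable:
  assumes "square_integrable \<mu> f" "square_integrable \<mu> g"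
  shows "integrable \<mu> (\<lambda>x. f x * g x)"
proof (rule Bochner_Integration.integrable_bound)
  show "integrable \<mu> (\<lambda>x. (f x)\<^sup>2 + (g x)\<^sup>2)"
    using assms unfolding square_integrable_def by simp
  show "(\<lambda>x. f x * g x) \<in> borel_measurable \<mu>"
    using assms unfolding square_integrable_def by (intro borel_measurable_times) auto
  have "\<bar>a * b\<bar> \<le> a\<^sup>2 + b\<^sup>2" for a b :: real
  proof -
    have "2 * \<bar>a * b\<bar> \<le> a\<^sup>2 + b\<^sup>2"
      using sum_squares_bound[of "\<bar>a\<bar>" "\<bar>b\<bar>"] by (simp add: abs_mult mult.assoc)
    then show ?thesis using abs_ge_zero[of "a * b"] by linarith
  qed
  then show "AE x in \<mu>. norm (f x * g x) \<le> norm ((f x)\<^sup>2 + (g x)\<^sup>2)"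
    by simp
qed


lemma square_integrable_scale:
  assumes "square_integrable \<mu> f"
  shows "square_integrable \<mu> (\<lambda>x. c * f x)"
  using assms by (simp add: square_integrable_def power_mult_distrib borel_measurable_times)

lemma square_integrable_add:
  assumes "square_integrable \<mu> f" "square_integrable \<mu> g"
  shows "square_integrable \<mu> (\<lambda>x. f x + g x)"
  using assms integrable_mult_square_integrable[OF assms]
  by (simp add: square_integrable_def power2_sum borel_measurable_add mult.assoc)

locale square_integrable_basis =
  fixes \<mu> :: "'a measure" and \<phi> :: "'a \<Rightarrow> real^'N"
  assumes square_integrable_component: "square_integrable \<mu> (\<lambda>y. \<phi> y $ i)"
begin

lemma square_integrable_inner: "square_integrable \<mu> (\<lambda>y. u \<bullet> \<phi> y)"
proof -
  have "square_integrable \<mu> (\<lambda>y. \<Sum>i\<in>I. u $ i * \<phi> y $ i)" if "finite I" for I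
    using that
  proof induction
    case empty
    show ?case by (simp add: square_integrable_def)
  next
    case (insert i I)
    then show ?case
      by (simp add: square_integrable_add square_integrable_scale square_integrable_component)
  qed
  then show ?thesis by (simp add: inner_vec_def)
qed

lemma inner_moment_vector:
  assumes f: "square_integrable \<mu> f"
  shows "u \<bullet> moment_vector \<mu> \<phi> f = (\<integral>y. (u \<bullet> \<phi> y) * f y \<partial>\<mu>)"
proof -
  have int: "integrable \<mu> (\<lambda>y. \<phi> y $ i * f y)" for i
    by (rule integrable_mult_square_integrable[OF square_integrable_component f])
  have "u \<bullet> moment_vector \<mu> \<phi> f = (\<integral>y. (\<Sum>i\<in>UNIV. u $ i * (\<phi> y $ i * f y)) \<partial>\<mu>)"
    using int by (simp add: inner_vec_def moment_vector_def l2_inner_def)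
  then show ?thesis by (simp add: inner_vec_def sum_distrib_right mult.assoc)
qed

text \<open>Reduces the Gram matrix to moment vectors, so that \<open>inner_moment_vector\<close>
  also evaluates its bilinear form.\<close>

lemma gram_matrix_mult_vec: "gram_matrix \<mu> \<phi> *v v = moment_vector \<mu> \<phi> (\<lambda>y. v \<bullet> \<phi> y)"
proof -
  have "(gram_matrix \<mu> \<phi> *v v) $ i = moment_vector \<mu> \<phi> (\<lambda>y. v \<bullet> \<phi> y) $ i" for i
  proof -
    have "(gram_matrix \<mu> \<phi> *v v) $ i = v \<bullet> moment_vector \<mu> \<phi> (\<lambda>y. \<phi> y $ i)"
      by (simp add: matrix_vector_mult_def gram_matrix_def moment_vector_def inner_vec_def
          l2_inner_def mult.commute)
    also have "\<dots> = moment_vector \<mu> \<phi> (\<lambda>y. v \<bullet> \<phi> y) $ i"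
      unfolding inner_moment_vector[OF square_integrable_component]
      by (simp add: moment_vector_def l2_inner_def mult.commute)
    finally show ?thesis .
  qed
  then show ?thesis by (simp add: vec_eq_iff)
qed

lemma inner_gram_matrix: "u \<bullet> (gram_matrix \<mu> \<phi> *v v) = (\<integral>y. (u \<bullet> \<phi> y) * (v \<bullet> \<phi> y) \<partial>\<mu>)"
  by (simp add: gram_matrix_mult_vec inner_moment_vector square_integrable_inner)

lemma inner_gram_matrix_commute:
  "u \<bullet> (gram_matrix \<mu> \<phi> *v v) = v \<bullet> (gram_matrix \<mu> \<phi> *v u)"
  by (simp add: inner_gram_matrix mult.commute)

lemma inner_gram_matrix_nonneg: "0 \<le> v \<bullet> (gram_matrix \<mu> \<phi> *v v)"
  by (simp add: inner_gram_matrix)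

text \<open>The quadratic form at v is the integral of the square of
  \<open>v \<bullet> \<phi> y\<close>. Kernel vectors are thus linear relations between the basis
  functions that hold almost everywhere.\<close>

lemma AE_inner_eq_0:
  assumes "gram_matrix \<mu> \<phi> *v v = 0"
  shows "AE y in \<mu>. v \<bullet> \<phi> y = 0"
proof -
  have "(\<integral>y. (v \<bullet> \<phi> y) * (v \<bullet> \<phi> y) \<partial>\<mu>) = 0"
    using inner_gram_matrix[of v v] assms by simp
  then have "AE y in \<mu>. (v \<bullet> \<phi> y) * (v \<bullet> \<phi> y) = 0"
    using integral_nonneg_eq_0_iff_AE[OF
        integrable_mult_square_integrable[OF square_integrable_inner square_integrable_inner]]
    by simp
  then show ?thesis by simp
qed

text \<open>A relation between the basis functions that holds almost everywhere annihilates the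
  moment vector, which is the condition of \<open>symmetric_matrix_solvable\<close>.\<close>

lemma normal_equations_solvable:
  assumes f: "square_integrable \<mu> f"
  obtains v where "gram_matrix \<mu> \<phi> *v v = moment_vector \<mu> \<phi> f"
proof (rule symmetric_matrix_solvable[OF inner_gram_matrix_commute])
  fix v assume "gram_matrix \<mu> \<phi> *v v = 0"
  then have "AE y in \<mu>. (v \<bullet> \<phi> y) * f y = 0"
    using AE_inner_eq_0 by fastforce
  then have "(\<integral>y. (v \<bullet> \<phi> y) * f y \<partial>\<mu>) = 0"
    by (rule integral_eq_zero_AE)
  then show "v \<bullet> moment_vector \<mu> \<phi> f = 0"
    by (simp add: inner_moment_vector[OF f])
qed

lemma l2_dist_sq_lin_comb:
  assumes f: "square_integrable \<mu> f"
  shows "l2_dist_sq \<mu> f (lin_comb \<phi> v) =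
    (\<integral>y. (f y)\<^sup>2 \<partial>\<mu>) - 2 * (v \<bullet> moment_vector \<mu> \<phi> f) + v \<bullet> (gram_matrix \<mu> \<phi> *v v)"
proof -
  have "l2_dist_sq \<mu> f (lin_comb \<phi> v) =
      (\<integral>y. (f y)\<^sup>2 - 2 * ((v \<bullet> \<phi> y) * f y) + (v \<bullet> \<phi> y) * (v \<bullet> \<phi> y) \<partial>\<mu>)"
    unfolding l2_dist_sq_def l2_inner_def lin_comb_eq_inner
    by (intro Bochner_Integration.integral_cong) (simp_all add: power2_eq_square algebra_simps)
  also have "\<dots> = (\<integral>y. (f y)\<^sup>2 \<partial>\<mu>) - 2 * (\<integral>y. (v \<bullet> \<phi> y) * f y \<partial>\<mu>)
      + (\<integral>y. (v \<bullet> \<phi> y) * (v \<bullet> \<phi> y) \<partial>\<mu>)"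
    using f integrable_mult_square_integrable[OF square_integrable_inner f, of v]
      integrable_mult_square_integrable[OF square_integrable_inner square_integrable_inner, of v v]
    by (simp add: square_integrable_def)
  finally show ?thesis by (simp add: inner_moment_vector[OF f] inner_gram_matrix)
qed

text \<open>Translates the seminorm in \<open>perturbed_singular_system\<close> into the L2 distance
  of the fitted functions.\<close>

lemma l2_dist_sq_lin_comb_lin_comb:
  "l2_dist_sq \<mu> (lin_comb \<phi> u) (lin_comb \<phi> v) = (u - v) \<bullet> (gram_matrix \<mu> \<phi> *v (u - v))"
  by (simp add: l2_dist_sq_def l2_inner_def lin_comb_eq_inner inner_gram_matrix inner_diff_left)

lemma best_approximation_lin_comb_iff:
  assumes f: "square_integrable \<mu> f"
  shows "best_approximation \<mu> \<phi> f (lin_comb \<phi> v) \<longleftrightarrow>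
    gram_matrix \<mu> \<phi> *v v = moment_vector \<mu> \<phi> f"
proof -
  have "best_approximation \<mu> \<phi> f (lin_comb \<phi> v) \<longleftrightarrow>
      (\<forall>w. l2_dist_sq \<mu> f (lin_comb \<phi> v) \<le> l2_dist_sq \<mu> f (lin_comb \<phi> w))"
    unfolding best_approximation_def is_arg_min_linorder by blast
  also have "\<dots> \<longleftrightarrow> gram_matrix \<mu> \<phi> *v v = moment_vector \<mu> \<phi> f"
    unfolding l2_dist_sq_lin_comb[OF f]
    by (rule quadratic_minimizer_iff[OF inner_gram_matrix_commute inner_gram_matrix_nonneg])
  finally show ?thesis .
qed

end

text \<open>Coefficients need not converge when the Gram matrix is singular, so the limit is stated
  for their images under G and for the L2 distance to a best approximation. The exceptional null set
  does not depend on the choice of minimizers.\<close>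

theorem mainTheorem4:
  fixes P :: "'w measure"
    and \<mu> :: "(real^'n::finite) measure"
    and x :: "nat \<Rightarrow> 'w \<Rightarrow> real^'n"
    and xdot :: "nat \<Rightarrow> 'w \<Rightarrow> real^'n"
    and F :: "real^'n \<Rightarrow> real^'n"
    and \<phi> :: "real^'n \<Rightarrow> real^'N::finite"
  assumes "prob_space P"
    and "prob_space.indep_vars P (\<lambda>_. borel) x UNIV"
    and "\<And>k. distr P borel (x k) = \<mu>"
    and "\<And>k \<omega>. xdot k \<omega> = F (x k \<omega>)"
    and "\<And>i. square_integrable \<mu> (\<lambda>y. \<phi> y $ i)"
    and "\<And>l. square_integrable \<mu> (\<lambda>y. F y $ l)"
  shows
    "let \<Phi> = (\<lambda>\<omega> k. \<phi> (x k \<omega>));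
         Xdot = (\<lambda>\<omega> k. xdot k \<omega>);
         G = gram_matrix \<mu> \<phi>;
         b = (\<lambda>l. moment_vector \<mu> \<phi> (\<lambda>y. F y $ l))
     in
       (\<forall>\<omega> m \<Xi>. sindy_minimizer m (\<Phi> \<omega>) (Xdot \<omega>) \<Xi> \<longleftrightarrow>
          mult_transpose m (\<Phi> \<omega>) (\<Phi> \<omega>) ** transpose \<Xi> = mult_transpose m (\<Phi> \<omega>) (Xdot \<omega>))
     \<and> (\<forall>\<omega> m \<Xi>.
          mult_transpose m (\<Phi> \<omega>) (\<Phi> \<omega>) ** transpose \<Xi> = mult_transpose m (\<Phi> \<omega>) (Xdot \<omega>) \<longleftrightarrow>
          (\<forall>l. mult_transpose m (\<Phi> \<omega>) (\<Phi> \<omega>) *v row l \<Xi>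
             = mult_row_transpose m (\<Phi> \<omega>) (data_row (Xdot \<omega>) l)))
     \<and> (AE \<omega> in P.
          (\<forall>i j. (\<lambda>m. ((1 / real m) *\<^sub>R mult_transpose m (\<Phi> \<omega>) (\<Phi> \<omega>)) $ i $ j)
             \<longlonglongrightarrow> l2_inner \<mu> (\<lambda>y. \<phi> y $ i) (\<lambda>y. \<phi> y $ j))
        \<and> (\<forall>l i. (\<lambda>m. ((1 / real m) *\<^sub>R
                mult_row_transpose m (\<Phi> \<omega>) (data_row (Xdot \<omega>) l)) $ i)
             \<longlonglongrightarrow> l2_inner \<mu> (\<lambda>y. \<phi> y $ i) (\<lambda>y. F y $ l)))
     \<and> (\<exists>\<Xi>. \<forall>l. least_squares_solution G (b l) (row l \<Xi>))
     \<and> (\<forall>\<Xi> l. (least_squares_solution G (b l) (row l \<Xi>) \<longleftrightarrow> G *v row l \<Xi> = b l)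
            \<and> (least_squares_solution G (b l) (row l \<Xi>) \<longleftrightarrow>
               best_approximation \<mu> \<phi> (\<lambda>y. F y $ l) (lin_comb \<phi> (row l \<Xi>))))
     \<and> (AE \<omega> in P. \<forall>\<Xi>. (\<forall>m. sindy_minimizer m (\<Phi> \<omega>) (Xdot \<omega>) (\<Xi> m)) \<longrightarrow>
          (\<forall>l. (\<lambda>m. G *v row l (\<Xi> m)) \<longlonglongrightarrow> b l
             \<and> (\<forall>g. best_approximation \<mu> \<phi> (\<lambda>y. F y $ l) g \<longrightarrow>
                  (\<lambda>m. l2_dist_sq \<mu> (lin_comb \<phi> (row l (\<Xi> m))) g) \<longlonglongrightarrow> 0)))"
proof -
  interpret P: prob_space P by fact
  interpret B: square_integrable_basis \<mu> \<phi> by unfold_locales fact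
  let ?\<Phi> = "\<lambda>\<omega> k. \<phi> (x k \<omega>)" and ?X = "\<lambda>\<omega> k. xdot k \<omega>"
  let ?G = "gram_matrix \<mu> \<phi>" and ?b = "\<lambda>l. moment_vector \<mu> \<phi> (\<lambda>y. F y $ l)"
  let ?A = "\<lambda>\<omega> m. mult_transpose m (?\<Phi> \<omega>) (?\<Phi> \<omega>)"
  let ?r = "\<lambda>\<omega> l m. mult_row_transpose m (?\<Phi> \<omega>) (data_row (?X \<omega>) l)"
  have X [measurable]: "x k \<in> measurable P borel" for k
    using assms(2) by (simp add: P.indep_vars_def)
  note slln = P.strong_law_of_large_numbers[OF assms(2,3)]
  have lim_A: "AE \<omega> in P. \<forall>i j. (\<lambda>m. ((1 / real m) *\<^sub>R ?A \<omega> m) $ i $ j)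
      \<longlonglongrightarrow> l2_inner \<mu> (\<lambda>y. \<phi> y $ i) (\<lambda>y. \<phi> y $ j)"
  proof (intro eventually_all_finite)
    fix i j
    have "integrable \<mu> (\<lambda>y. \<phi> y $ i * \<phi> y $ j)"
      by (intro integrable_mult_square_integrable assms)
    from slln[OF this] show "AE \<omega> in P. (\<lambda>m. ((1 / real m) *\<^sub>R ?A \<omega> m) $ i $ j)
      \<longlonglongrightarrow> l2_inner \<mu> (\<lambda>y. \<phi> y $ i) (\<lambda>y. \<phi> y $ j)"
      by (simp add: mult_transpose_def l2_inner_def)
  qed
  have lim_r: "AE \<omega> in P. \<forall>l i. (\<lambda>m. ((1 / real m) *\<^sub>R ?r \<omega> l m) $ i)
      \<longlonglongrightarrow> l2_inner \<mu> (\<lambda>y. \<phi> y $ i) (\<lambda>y. F y $ l)"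
  proof (intro eventually_all_finite)
    fix l i
    have "integrable \<mu> (\<lambda>y. \<phi> y $ i * F y $ l)"
      by (intro integrable_mult_square_integrable assms)
    from slln[OF this] show "AE \<omega> in P. (\<lambda>m. ((1 / real m) *\<^sub>R ?r \<omega> l m) $ i)
      \<longlonglongrightarrow> l2_inner \<mu> (\<lambda>y. \<phi> y $ i) (\<lambda>y. F y $ l)"
      by (simp add: mult_row_transpose_def data_row_def l2_inner_def assms(4))
  qed
  \<comment> \<open>The kernel may be uncountable, so null sets are collected only over a finite
    basis \<open>U\<close> and all k; linearity extends the relations to the span.\<close>
  have ker: "AE \<omega> in P. \<forall>u. ?G *v u = 0 \<longrightarrow> (\<forall>k. u \<bullet> \<phi> (x k \<omega>) = 0)"
  proof -
    obtain U where U: "U \<subseteq> {u. ?G *v u = 0}" "independent U" "{u. ?G *v u = 0} \<subseteq> span U"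
      by (rule basis_exists)
    have "AE \<omega> in P. u \<bullet> \<phi> (x k \<omega>) = 0" if "u \<in> U" for u k
    proof (rule AE_distrD[OF X])
      show "AE y in distr P borel (x k). u \<bullet> \<phi> y = 0"
        using B.AE_inner_eq_0[of u] U(1) that unfolding assms(3) by blast
    qed
    then have "AE \<omega> in P. \<forall>u\<in>U. \<forall>k. u \<bullet> \<phi> (x k \<omega>) = 0"
      using U(2) by (intro AE_finite_allI independent_imp_finite) (simp_all add: AE_all_countable)
    then show ?thesis
    proof eventually_elim
      case (elim \<omega>)
      have "span U \<subseteq> {u. \<forall>k. u \<bullet> \<phi> (x k \<omega>) = 0}"
        using elim by (intro span_minimal) (auto simp: subspace_def inner_add_left)
      then show ?case using U(3) by blast
    qed
  qed
  have "\<exists>v. ?G *v v = ?b l" for l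
    by (rule B.normal_equations_solvable[OF assms(6)[of l]]) (rule exI)
  then obtain s where s: "?G *v s l = ?b l" for l by metis
  have ls: "least_squares_solution ?G (?b l) v \<longleftrightarrow> ?G *v v = ?b l" for l v
    by (rule least_squares_solution_iff[OF s])
  have best: "best_approximation \<mu> \<phi> (\<lambda>y. F y $ l) (lin_comb \<phi> v) \<longleftrightarrow> ?G *v v = ?b l" for l v
    by (rule B.best_approximation_lin_comb_iff[OF assms(6)])
  have exists: "\<exists>\<Xi>. \<forall>l. least_squares_solution ?G (?b l) (row l \<Xi>)"
    by (rule exI[of _ "\<chi> l. s l"]) (simp add: ls s row_def vec_lambda_eta)
  have conv: "AE \<omega> in P. \<forall>\<Xi>. (\<forall>m. sindy_minimizer m (?\<Phi> \<omega>) (?X \<omega>) (\<Xi> m)) \<longrightarrow>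
      (\<forall>l. (\<lambda>m. ?G *v row l (\<Xi> m)) \<longlonglongrightarrow> ?b l
        \<and> (\<forall>g. best_approximation \<mu> \<phi> (\<lambda>y. F y $ l) g \<longrightarrow>
              (\<lambda>m. l2_dist_sq \<mu> (lin_comb \<phi> (row l (\<Xi> m))) g) \<longlonglongrightarrow> 0))"
    using lim_A lim_r ker
  proof eventually_elim
    case (elim \<omega>)
    show ?case
    proof (intro allI impI)
      fix \<Xi> l
      assume min: "\<forall>m. sindy_minimizer m (?\<Phi> \<omega>) (?X \<omega>) (\<Xi> m)"
      have A: "(\<lambda>m. (1 / real m) *\<^sub>R ?A \<omega> m) \<longlonglongrightarrow> ?G"
        using elim(1) by (intro vec_tendstoI) (simp add: gram_matrix_def)
      have r: "(\<lambda>m. (1 / real m) *\<^sub>R ?r \<omega> l m) \<longlonglongrightarrow> ?b l"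
        using elim(2) by (intro vec_tendstoI) (simp add: moment_vector_def)
      \<comment> \<open>At m = 0 the factor \<open>1 / real m\<close> is 0, so the equation holds
        trivially there.\<close>
      have eq: "((1 / real m) *\<^sub>R ?A \<omega> m) *v row l (\<Xi> m) = (1 / real m) *\<^sub>R ?r \<omega> l m" for m
        using min by (simp add: sindy_minimizer_iff flip: scaleR_matrix_vector_assoc)
      have ker: "((1 / real m) *\<^sub>R ?A \<omega> m) *v u = 0" if "?G *v u = 0" for m u
        using elim(3) that
        by (simp add: mult_transpose_mult_vec inner_commute flip: scaleR_matrix_vector_assoc)
      note lim = perturbed_singular_system[OF B.inner_gram_matrix_commute A r eq ker]
      show "(\<lambda>m. ?G *v row l (\<Xi> m)) \<longlonglongrightarrow> ?b l
        \<and> (\<forall>g. best_approximation \<mu> \<phi> (\<lambda>y. F y $ l) g \<longrightarrow>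
              (\<lambda>m. l2_dist_sq \<mu> (lin_comb \<phi> (row l (\<Xi> m))) g) \<longlonglongrightarrow> 0)"
      proof (intro conjI allI impI)
        show "(\<lambda>m. ?G *v row l (\<Xi> m)) \<longlonglongrightarrow> ?b l" by (rule lim(1))
      next
        fix g assume g: "best_approximation \<mu> \<phi> (\<lambda>y. F y $ l) g"
        then obtain a where a: "g = lin_comb \<phi> a"
          by (auto simp: best_approximation_def is_arg_min_def)
        \<comment> \<open>Any coefficient vector \<open>a\<close> of g solves the normal equations
          by \<open>best\<close>, as the second limit requires.\<close>
        show "(\<lambda>m. l2_dist_sq \<mu> (lin_comb \<phi> (row l (\<Xi> m))) g) \<longlonglongrightarrow> 0"
          using lim(2)[of a] g best unfolding a B.l2_dist_sq_lin_comb_lin_comb by blast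
      qed
    qed
  qed
  show ?thesis
    unfolding Let_def
    using lim_A lim_r exists conv
    by (intro conjI allI) (simp_all add: sindy_minimizer_iff normal_equations_rows_iff ls best)
qed

end
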